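(* Let $q\ge1$, let $G$ be a $(q+1)$-regular finite graph (loops and multiple edges allowed) with $N$ vertices, and let $w_k$ be the $k$-th coefficient (the coefficient of $\beta^k$) of $\omega_G(\beta)$. Then $$w_{N-k}=w_k\,q^{N-2k}\qquad\text{for }0\le k\le N.$$
   Context: Graphs are finite undirected multigraphs; loops and multiple edges are allowed. The degree of a vertex is the number of edge-ends at it (a loop counts twice); a graph is $(q+1)$-regular if every vertex has degree $q+1$. For $s\subset E$, $d_i(s)$ is the degree of vertex $i$ in the spanning subgraph $(V,s)$. The polynomials $f_n(x)$, $n\ge 0$, are defined by $f_0(x)=1$, $f_1(x)=0$, $f_{n+1}(x)=x f_n(x)+f_{n-1}(x)$ for $n\ge1$. For $G=(V,E)$ put $\theta_G(\beta,\gamma):=\sum_{s\subset E}\beta^{|s|}\prod_{i\in V}f_{d_i(s)}(\gamma)$ and $$\omega_G(\beta):=\frac{\theta_G(\beta,2\sqrt{-1})}{(1-\beta)^{|E|-|V|}},$$ which is a polynomial in $\mathbb{Z}[\beta]$. *)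

theory Defs
  imports "HOL-Library.Multiset" "HOL-Computational_Algebra.Computational_Algebra" Complex_Main
begin

(* Undirected multigraph: the two ends of an edge form a multiset of size 2,
   {#u, v#} for an ordinary edge and {#v, v#} for a loop. *)
record ('v, 'e) multigraph =
  verts :: "'v set"
  edges :: "'e set"
  ends :: "'e \<Rightarrow> 'v multiset"

definition finite_multigraph :: "('v, 'e) multigraph \<Rightarrow> bool" where
  "finite_multigraph G \<longleftrightarrow> finite (verts G) \<and> finite (edges G) \<and>
     (\<forall>e\<in>edges G. size (ends G e) = 2 \<and> set_mset (ends G e) \<subseteq> verts G)"

(* The degree d_i(s); a loop at i has multiplicity 2 of i among its ends. *)
definition degree_in :: "('v, 'e) multigraph \<Rightarrow> 'e set \<Rightarrow> 'v \<Rightarrow> nat" where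
  "degree_in G s i = (\<Sum>e\<in>s. count (ends G e) i)"

definition regular :: "nat \<Rightarrow> ('v, 'e) multigraph \<Rightarrow> bool" where
  "regular r G \<longleftrightarrow> (\<forall>i\<in>verts G. degree_in G (edges G) i = r)"

fun f_poly :: "nat \<Rightarrow> 'a::comm_ring_1 \<Rightarrow> 'a" where
  "f_poly 0 x = 1"
| "f_poly (Suc 0) x = 0"
| "f_poly (Suc (Suc n)) x = x * f_poly (Suc n) x + f_poly n x"

(* \<theta> has integer coefficients, so it can be evaluated in every commutative ring. *)
definition theta :: "('v, 'e) multigraph \<Rightarrow> 'a::comm_ring_1 \<Rightarrow> 'a \<Rightarrow> 'a" where
  "theta G b c = (\<Sum>s\<in>Pow (edges G). b ^ card s * (\<Prod>i\<in>verts G. f_poly (degree_in G s i) c))"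

(* \<omega> as a rational function, an element of the field of fractions of the complex
   polynomials: b is the indeterminate \<beta>, and c is the constant 2 * sqrt (-1).
   The exponent |E| - |V| is an integer and may be negative. *)
definition omega :: "('v, 'e) multigraph \<Rightarrow> complex poly fract" where
  "omega G = (let b = to_fract [:0, 1:]; c = to_fract [:2 * \<i>:] in
     theta G b c / (1 - b) powi (int (card (edges G)) - int (card (verts G))))"

end

theory Submission
  imports Defs
begin

text \<open>
  The characteristic polynomial of the recurrence for \<open>f_poly n (2 * \<i>)\<close> is \<open>(x - \<i>)\<^sup>2\<close>; this double
  root makes \<open>f_poly n (2 * \<i>) = (1 - n) * \<i> ^ n\<close> affine in \<open>n\<close> up to a power of \<open>\<i>\<close>. The powers of
  \<open>\<i>\<close> multiply, by the handshake identity, to \<open>(-1) ^ card s\<close>, so that \<open>\<theta>\<close> becomes the sum of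
  \<open>z ^ card s * (\<Prod>i. 1 - d\<^sub>i(s))\<close> over all edge sets \<open>s\<close>, with \<open>z = -\<beta>\<close>.

  In such a sum the product can be expanded: every vertex in some set of vertices selects one of its
  incident edge-ends in \<open>s\<close>. Summing over \<open>s\<close> first, a selected edge contributes
  \<open>t = z / (1 + z)\<close> relative to an unselected one. If all selections were independent, the vertex \<open>i\<close>
  would contribute \<open>1 - t * d\<^sub>i\<close>; an edge selected from both its ends contributes \<open>t\<close> instead of the
  \<open>t\<^sup>2\<close> of independent selections, and the edges to which the correction \<open>t - t\<^sup>2\<close> is applied form a
  matching. This is \<open>sum_edge_sets_eq_sum_matchings\<close>, where the expansion is carried out one
  edge at a time. For a \<open>(q+1)\<close>-regular graph it gives
  \<open>\<omega> = (\<Sum>D. (-\<beta>) ^ card D * (1 + q * \<beta>) ^ (N - 2 * card D))\<close>, summed over the matchings \<open>D\<close>.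

  Each summand has the claimed symmetry. Under \<open>\<beta> \<mapsto> 1 / (q\<^sup>2 * \<beta>)\<close>, the factor \<open>-\<beta>\<close> is restored by
  multiplying with \<open>(q * \<beta>)\<^sup>2\<close>, and \<open>1 + q * \<beta>\<close> by multiplying with \<open>q * \<beta>\<close>; altogether this takes
  the factor \<open>(q * \<beta>) ^ N\<close>, whatever the matching. On coefficients it is the symmetry of the
  binomial coefficients.
\<close>

section \<open>Matchings\<close>

text \<open>The degree condition excludes loops, as a loop has degree two at its vertex.\<close>

definition matchings :: "('v, 'e) multigraph \<Rightarrow> 'e set \<Rightarrow> 'e set set" where
  "matchings G S = {D. D \<subseteq> S \<and> (\<forall>i\<in>verts G. degree_in G D i \<le> 1)}"

definition unmatched :: "('v, 'e) multigraph \<Rightarrow> 'e set \<Rightarrow> 'v set" where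
  "unmatched G D = {i \<in> verts G. degree_in G D i = 0}"

lemma degree_in_empty [simp]: "degree_in G {} i = 0"
  by (simp add: degree_in_def)

lemma degree_in_insert:
  assumes "finite D" "e \<notin> D"
  shows "degree_in G (insert e D) i = count (ends G e) i + degree_in G D i"
  using assms by (simp add: degree_in_def)

lemma finite_matchings: "finite S \<Longrightarrow> finite (matchings G S)"
  by (rule finite_subset[of _ "Pow S"]) (auto simp: matchings_def)

lemma matchings_empty [simp]: "matchings G {} = {{}}"
  by (auto simp: matchings_def)

lemma finite_unmatched: "finite_multigraph G \<Longrightarrow> finite (unmatched G D)"
  by (simp add: unmatched_def finite_multigraph_def)

lemma handshake:
  assumes "finite_multigraph G" "s \<subseteq> edges G"
  shows "(\<Sum>i\<in>verts G. degree_in G s i) = 2 * card s"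
proof -
  have fin: "finite (verts G)"
    and "\<And>e. e \<in> s \<Longrightarrow> size (ends G e) = 2 \<and> set_mset (ends G e) \<subseteq> verts G"
    using assms by (auto simp: finite_multigraph_def)
  then have ends: "(\<Sum>i\<in>verts G. count (ends G e) i) = 2" if "e \<in> s" for e
    using that sum.mono_neutral_left[OF fin, of "set_mset (ends G e)" "count (ends G e)"]
    by (auto simp: size_multiset_overloaded_eq not_in_iff)
  have "(\<Sum>i\<in>verts G. degree_in G s i) = (\<Sum>e\<in>s. \<Sum>i\<in>verts G. count (ends G e) i)"
    unfolding degree_in_def by (rule sum.swap)
  then show ?thesis
    using ends by simp
qed

lemma card_unmatched:
  assumes "finite_multigraph G" "D \<in> matchings G (edges G)"
  shows "card (verts G) = 2 * card D + card (unmatched G D)"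
proof -
  have fin: "finite (verts G)"
    using assms(1) by (simp add: finite_multigraph_def)
  have "card (verts G) = (\<Sum>i\<in>verts G. degree_in G D i + (if degree_in G D i = 0 then 1 else 0))"
  proof -
    have "degree_in G D i + (if degree_in G D i = 0 then 1 else 0) = 1" if "i \<in> verts G" for i
      using assms(2) that by (force simp: matchings_def le_Suc_eq)
    then show ?thesis by simp
  qed
  also have "\<dots> = 2 * card D + card (unmatched G D)"
    using assms handshake[OF assms(1), of D] fin
    by (simp add: sum.distrib matchings_def unmatched_def sum.If_cases Int_def)
  finally show ?thesis .
qed

text \<open>A new edge can join a matching exactly when its ends are two distinct unmatched vertices.\<close>

definition addable :: "('v, 'e) multigraph \<Rightarrow> 'e \<Rightarrow> 'e set \<Rightarrow> bool" where
  "addable G e D \<longleftrightarrow> (\<forall>i. count (ends G e) i \<le> 1) \<and> set_mset (ends G e) \<subseteq> unmatched G D"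

lemma matchings_insert:
  assumes G: "finite_multigraph G" and e: "e \<in> edges G" and S: "finite S" "e \<notin> S"
  shows "matchings G (insert e S) =
    matchings G S \<union> insert e ` {D \<in> matchings G S. addable G e D}"
proof -
  have V: "set_mset (ends G e) \<subseteq> verts G"
    using G e by (auto simp: finite_multigraph_def)
  have *: "insert e D \<in> matchings G (insert e S) \<longleftrightarrow> D \<in> matchings G S \<and> addable G e D"
    if D: "D \<subseteq> S" for D
  proof -
    have deg: "degree_in G (insert e D) i = count (ends G e) i + degree_in G D i" for i
      using D S by (intro degree_in_insert) (auto intro: finite_subset)
    have "(\<forall>i\<in>verts G. count (ends G e) i + degree_in G D i \<le> 1) \<longleftrightarrow>
      (\<forall>i\<in>verts G. degree_in G D i \<le> 1) \<and> (\<forall>i. count (ends G e) i \<le> 1) \<and>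
      (\<forall>i\<in>#ends G e. i \<in> verts G \<and> degree_in G D i = 0)" (is "?L \<longleftrightarrow> ?R")
    proof
      assume L: ?L
      have "count (ends G e) i \<le> 1" for i
        using L V by (cases "i \<in># ends G e") (fastforce simp: not_in_iff)+
      moreover have "i \<in> verts G \<and> degree_in G D i = 0" if "i \<in># ends G e" for i
      proof -
        have "i \<in> verts G" "count (ends G e) i > 0"
          using V that by auto
        moreover from this L have "count (ends G e) i + degree_in G D i \<le> 1" by blast
        ultimately show ?thesis by linarith
      qed
      ultimately show ?R using L by fastforce
    next
      assume R: ?R
      have "count (ends G e) i + degree_in G D i \<le> 1" if "i \<in> verts G" for i
        using R that by (cases "i \<in># ends G e") (auto simp: not_in_iff)
      then show ?L by blast
    qed
    then show ?thesis
      using D by (auto simp: matchings_def addable_def unmatched_def deg subset_iff)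
  qed
  have "D \<in> matchings G (insert e S) \<longleftrightarrow> D \<in> matchings G S" if "e \<notin> D" for D
    using that by (auto simp: matchings_def)
  moreover have "D \<in> insert e ` {D \<in> matchings G S. addable G e D} \<longleftrightarrow>
      D \<in> matchings G (insert e S)" if "e \<in> D" for D
  proof
    assume "D \<in> insert e ` {D \<in> matchings G S. addable G e D}"
    then show "D \<in> matchings G (insert e S)"
      using * by (auto simp: matchings_def)
  next
    assume D: "D \<in> matchings G (insert e S)"
    have "D = insert e (D - {e})" "D - {e} \<subseteq> S"
      using D that by (auto simp: matchings_def)
    with *[of "D - {e}"] D show "D \<in> insert e ` {D \<in> matchings G S. addable G e D}"
      by (metis (mono_tags, lifting) image_eqI mem_Collect_eq)
  qed
  moreover have "e \<notin> D" if "D \<in> matchings G S" for D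
    using that S by (auto simp: matchings_def)
  ultimately have "D \<in> matchings G (insert e S) \<longleftrightarrow>
      D \<in> matchings G S \<union> insert e ` {D \<in> matchings G S. addable G e D}" for D
    by (cases "e \<in> D") auto
  then show ?thesis
    by (rule set_eqI)
qed

lemma unmatched_insert:
  assumes "finite D" "e \<notin> D"
  shows "unmatched G (insert e D) = unmatched G D - set_mset (ends G e)"
  using assms by (auto simp: unmatched_def degree_in_insert simp flip: not_in_iff)

section \<open>From edge sets to matchings\<close>

text \<open>
  The effect of one edge with ends \<open>M\<close>: for two distinct vertices it is the identity
  \<open>b\<^sub>u * b\<^sub>v + z * (b\<^sub>u - 1) * (b\<^sub>v - 1) = (1 + z) * ((b\<^sub>u - t) * (b\<^sub>v - t) + t - t\<^sup>2)\<close>. When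
  only one factor changes, the case of a loop or of a single end in \<open>U\<close>, averaging the unchanged and
  the changed product with weights \<open>1 - t\<close> and \<open>t\<close> shifts that factor by \<open>t\<close> times its change, and no
  correction arises.
\<close>

lemma edge_step:
  fixes b :: "'v \<Rightarrow> 'a::comm_ring_1"
  assumes U: "finite U" and M: "size M = 2" and t: "(1 + z) * t = z"
  shows "(\<Prod>i\<in>U. b i) + z * (\<Prod>i\<in>U. b i - of_nat (count M i)) =
    (1 + z) * ((\<Prod>i\<in>U. b i - t * of_nat (count M i)) +
      (if (\<forall>i. count M i \<le> 1) \<and> set_mset M \<subseteq> U then (t - t\<^sup>2) * (\<Prod>i\<in>U - set_mset M. b i) else 0))"
proof -
  obtain u v where M_eq: "M = {#u, v#}"
  proof -
    from M obtain u M' where "M = add_mset u M'" "size M' = 1"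
      using size_eq_Suc_imp_eq_union[of M 1] by auto
    then show ?thesis
      using that size_1_singleton_mset by blast
  qed
  define P where "P = (\<Prod>i\<in>U - {u, v}. b i)"
  have split: "(\<Prod>i\<in>U. b i - x * of_nat (count M i)) =
      P * (\<Prod>i\<in>U \<inter> {u, v}. b i - x * of_nat (count M i))" for x
  proof -
    have "(\<Prod>i\<in>U - {u, v}. b i - x * of_nat (count M i)) = P"
      unfolding P_def M_eq by (rule prod.cong) auto
    then show ?thesis
      using prod.Int_Diff[OF U, of "\<lambda>i. b i - x * of_nat (count M i)" "{u, v}"]
      by (simp add: mult.commute)
  qed
  note splits = split[of 0, simplified] split[of 1, simplified] split[of t]
  \<comment> \<open>The two ways in which \<open>t\<close> enters: linearly, and through the product of two shifted factors.\<close>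
  have affine: "P * x + z * (P * (x - y)) = (1 + z) * (P * (x - t * y))" for x y
    using arg_cong[OF t, of "\<lambda>w. w * (P * y)"] by (simp add: algebra_simps)
  have bilinear: "P * (x * y) + z * (P * ((x - 1) * (y - 1))) =
      (1 + z) * (P * ((x - t) * (y - t)) + (t - t\<^sup>2) * P)" for x y
  proof -
    have "(1 + z) * (P * ((x - t) * (y - t)) + (t - t\<^sup>2) * P) =
        (1 + z) * P * (x * y) - ((1 + z) * t) * P * (x + y) + ((1 + z) * t) * P"
      by (simp add: algebra_simps power2_eq_square)
    then show ?thesis
      unfolding t by (simp add: algebra_simps)
  qed
  consider "u = v" | "u \<noteq> v" "u \<in> U" "v \<in> U" | "u \<noteq> v" "u \<in> U" "v \<notin> U"
    | "u \<noteq> v" "u \<notin> U" "v \<in> U" | "u \<noteq> v" "u \<notin> U" "v \<notin> U"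
    by blast
  then show ?thesis
  proof cases
    case 1
    then have loop: "\<not> (\<forall>i. count M i \<le> 1)"
      by (auto simp: M_eq intro!: exI[of _ u])
    show ?thesis
      using 1 affine[of "b u" 2] loop unfolding splits
      by (cases "u \<in> U") (simp_all add: M_eq algebra_simps)
  next
    case 2
    then have "\<forall>i. count M i \<le> 1" "set_mset M \<subseteq> U" "U \<inter> {u, v} = {u, v}"
      by (auto simp: M_eq)
    with 2 bilinear[of "b u" "b v"] show ?thesis
      unfolding splits by (simp add: M_eq P_def)
  next
    case 3
    then have "\<not> set_mset M \<subseteq> U" "U \<inter> {u, v} = {u}"
      by (auto simp: M_eq)
    with 3 affine[of "b u" 1] show ?thesis
      unfolding splits by (simp add: M_eq)
  next
    case 4
    then have "\<not> set_mset M \<subseteq> U" "U \<inter> {u, v} = {v}"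
      by (auto simp: M_eq)
    with 4 affine[of "b v" 1] show ?thesis
      unfolding splits by (simp add: M_eq)
  next
    case 5
    then have "\<not> set_mset M \<subseteq> U" "U \<inter> {u, v} = {}"
      by (auto simp: M_eq)
    with 5 show ?thesis
      unfolding splits by (simp add: M_eq algebra_simps)
  qed
qed

text \<open>
  The vertex parameters \<open>a\<close> are arbitrary because the edge sets containing the new edge are summed by
  the induction hypothesis for the shifted parameters \<open>a i - count (ends G e) i\<close>.
\<close>

lemma sum_edge_sets_eq_sum_matchings:
  fixes a :: "'v \<Rightarrow> 'a::comm_ring_1"
  assumes G: "finite_multigraph G" and t: "(1 + z) * t = z" and S: "S \<subseteq> edges G"
  shows "(\<Sum>s\<in>Pow S. z ^ card s * (\<Prod>i\<in>verts G. a i - of_nat (degree_in G s i))) =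
    (1 + z) ^ card S * (\<Sum>D\<in>matchings G S. (t - t\<^sup>2) ^ card D *
      (\<Prod>i\<in>unmatched G D. a i - t * of_nat (degree_in G S i)))"
proof -
  have "finite S"
    using G S by (auto simp: finite_multigraph_def intro: finite_subset)
  then show ?thesis
    using S
  proof (induction S arbitrary: a rule: finite_induct)
    case empty
    show ?case by (simp add: unmatched_def)
  next
    case (insert e S)
    let ?F = "\<lambda>S (a :: 'v \<Rightarrow> 'a).
      \<Sum>s\<in>Pow S. z ^ card s * (\<Prod>i\<in>verts G. a i - of_nat (degree_in G s i))"
    let ?c = "\<lambda>i. of_nat (count (ends G e) i) :: 'a"
    define b where "b = (\<lambda>i. a i - t * of_nat (degree_in G S i))"
    have eE: "e \<in> edges G" and SE: "S \<subseteq> edges G"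
      using insert.prems by auto
    have M: "size (ends G e) = 2"
      using G eE by (auto simp: finite_multigraph_def)
    have new: "finite s" "e \<notin> s" if "s \<subseteq> S" for s
      using that insert.hyps finite_subset by auto
    have deg: "degree_in G (insert e s) i = count (ends G e) i + degree_in G s i" if "s \<subseteq> S" for s i
      using new[OF that] by (rule degree_in_insert)
    have sub: "D \<subseteq> S" if "D \<in> matchings G S" for D
      using that by (simp add: matchings_def)
    have fin: "finite (matchings G S)"
      by (simp add: finite_matchings insert.hyps)
    have inj: "inj_on (insert e) A" if "\<And>D. D \<in> A \<Longrightarrow> e \<notin> D" for A
      using that by (intro inj_onI) (metis insert_ident)
    have "?F (insert e S) a = ?F S a + (\<Sum>s\<in>insert e ` Pow S.
        z ^ card s * (\<Prod>i\<in>verts G. a i - of_nat (degree_in G s i)))"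
      unfolding Pow_insert using insert.hyps by (intro sum.union_disjoint) auto
    also have "(\<Sum>s\<in>insert e ` Pow S.
        z ^ card s * (\<Prod>i\<in>verts G. a i - of_nat (degree_in G s i))) = z * ?F S (\<lambda>i. a i - ?c i)"
      using new
      by (subst sum.reindex) (auto intro!: inj sum.cong simp: sum_distrib_left deg algebra_simps)
    also have "?F S a + z * ?F S (\<lambda>i. a i - ?c i) =
        (1 + z) ^ card S * (\<Sum>D\<in>matchings G S. (t - t\<^sup>2) ^ card D *
          ((\<Prod>i\<in>unmatched G D. b i) + z * (\<Prod>i\<in>unmatched G D. b i - ?c i)))"
      unfolding insert.IH[OF SE] b_def
      by (simp add: sum_distrib_left sum.distrib algebra_simps)
    also have "\<dots> = (1 + z) ^ card S * (\<Sum>D\<in>matchings G S. (t - t\<^sup>2) ^ card D *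
          ((1 + z) * ((\<Prod>i\<in>unmatched G D. b i - t * ?c i) + (if addable G e D
            then (t - t\<^sup>2) * (\<Prod>i\<in>unmatched G D - set_mset (ends G e). b i) else 0))))"
      unfolding edge_step[OF finite_unmatched[OF G] M t] addable_def ..
    also have "\<dots> = (1 + z) ^ card (insert e S) * (\<Sum>D\<in>matchings G S. (t - t\<^sup>2) ^ card D *
          ((\<Prod>i\<in>unmatched G D. b i - t * ?c i) + (if addable G e D
            then (t - t\<^sup>2) * (\<Prod>i\<in>unmatched G D - set_mset (ends G e). b i) else 0)))"
      using insert.hyps by (simp add: sum_distrib_left mult_ac)
    also have "(\<Sum>D\<in>matchings G S. (t - t\<^sup>2) ^ card D *
          ((\<Prod>i\<in>unmatched G D. b i - t * ?c i) + (if addable G e D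
            then (t - t\<^sup>2) * (\<Prod>i\<in>unmatched G D - set_mset (ends G e). b i) else 0))) =
        (\<Sum>D\<in>matchings G S. (t - t\<^sup>2) ^ card D * (\<Prod>i\<in>unmatched G D. b i - t * ?c i)) +
        (\<Sum>D\<in>{D \<in> matchings G S. addable G e D}. (t - t\<^sup>2) ^ Suc (card D) *
          (\<Prod>i\<in>unmatched G D - set_mset (ends G e). b i))"
      unfolding sum.inter_filter[OF fin]
      by (simp add: sum.distrib[symmetric] algebra_simps if_distrib cong: if_cong)
    also have "(\<Sum>D\<in>{D \<in> matchings G S. addable G e D}. (t - t\<^sup>2) ^ Suc (card D) *
          (\<Prod>i\<in>unmatched G D - set_mset (ends G e). b i)) =
        (\<Sum>D\<in>insert e ` {D \<in> matchings G S. addable G e D}. (t - t\<^sup>2) ^ card D *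
          (\<Prod>i\<in>unmatched G D. b i - t * ?c i))"
    proof (subst sum.reindex)
      show "inj_on (insert e) {D \<in> matchings G S. addable G e D}"
        using new sub by (intro inj) blast
      \<comment> \<open>The vertices left unmatched by \<open>insert e D\<close> are not ends of \<open>e\<close>, so the shift vanishes there.\<close>
      have "(\<Prod>i\<in>unmatched G (insert e D). b i - t * ?c i) =
          (\<Prod>i\<in>unmatched G D - set_mset (ends G e). b i)" if "D \<subseteq> S" for D
        unfolding unmatched_insert[OF new[OF that]]
        by (rule prod.cong) (auto simp: not_in_iff)
      then show "(\<Sum>D\<in>{D \<in> matchings G S. addable G e D}. (t - t\<^sup>2) ^ Suc (card D) *
            (\<Prod>i\<in>unmatched G D - set_mset (ends G e). b i)) =
          (\<Sum>D\<in>{D \<in> matchings G S. addable G e D}. ((\<lambda>D. (t - t\<^sup>2) ^ card D *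
            (\<Prod>i\<in>unmatched G D. b i - t * ?c i)) \<circ> insert e) D)"
        using new sub by (intro sum.cong) (auto simp: card_insert_disjoint)
    qed
    also have "(\<Sum>D\<in>matchings G S. (t - t\<^sup>2) ^ card D * (\<Prod>i\<in>unmatched G D. b i - t * ?c i)) +
        (\<Sum>D\<in>insert e ` {D \<in> matchings G S. addable G e D}. (t - t\<^sup>2) ^ card D *
          (\<Prod>i\<in>unmatched G D. b i - t * ?c i)) =
        (\<Sum>D\<in>matchings G (insert e S). (t - t\<^sup>2) ^ card D *
          (\<Prod>i\<in>unmatched G D. b i - t * ?c i))"
      unfolding matchings_insert[OF G eE insert.hyps] using fin sub new
      by (intro sum.union_disjoint[symmetric]) auto
    also have "(\<lambda>i. b i - t * ?c i) = (\<lambda>i. a i - t * of_nat (degree_in G (insert e S) i))"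
      by (simp add: b_def deg algebra_simps)
    finally show ?case .
  qed
qed

section \<open>The polynomial \<open>\<omega>\<close> of a regular graph\<close>

lemma f_poly_double_root:
  fixes w :: "'a::comm_ring_1"
  assumes "w\<^sup>2 = -1"
  shows "f_poly n (2 * w) = (1 - of_nat n) * w ^ n"
proof (induction n rule: induct_nat_012)
  case (ge2 n)
  have step: "w ^ Suc (Suc n) = - (w ^ n)"
    using assms by (metis mult_minus1 power_Suc power2_eq_square mult.assoc)
  have "f_poly (Suc (Suc n)) (2 * w) =
      2 * (1 - of_nat (Suc n)) * w ^ Suc (Suc n) + (1 - of_nat n) * w ^ n"
    unfolding f_poly.simps ge2 by (simp add: mult_ac)
  then show ?case
    unfolding step by (simp add: algebra_simps)
qed auto

lemma theta_double_root:
  fixes b w :: "'a::comm_ring_1"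
  assumes G: "finite_multigraph G" and w: "w\<^sup>2 = -1"
  shows "theta G b (2 * w) =
    (\<Sum>s\<in>Pow (edges G). (- b) ^ card s * (\<Prod>i\<in>verts G. 1 - of_nat (degree_in G s i)))"
  unfolding theta_def
proof (rule sum.cong[OF refl])
  fix s assume "s \<in> Pow (edges G)"
  then have "(\<Prod>i\<in>verts G. w ^ degree_in G s i) = (-1) ^ card s"
    using handshake[OF G, of s] w by (simp add: power_sum[symmetric] power_mult)
  then show "b ^ card s * (\<Prod>i\<in>verts G. f_poly (degree_in G s i) (2 * w)) =
      (- b) ^ card s * (\<Prod>i\<in>verts G. 1 - of_nat (degree_in G s i))"
    unfolding f_poly_double_root[OF w] by (simp add: prod.distrib power_minus[of b])
qed

lemma theta_regular:
  fixes b w :: "'a::field"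
  assumes G: "finite_multigraph G" and reg: "regular (q + 1) G"
    and w: "w\<^sup>2 = -1" and b: "b \<noteq> 1"
  shows "theta G b (2 * w) / (1 - b) powi (int (card (edges G)) - int (card (verts G))) =
    (\<Sum>D\<in>matchings G (edges G). (- b) ^ card D * (1 + of_nat q * b) ^ (card (verts G) - 2 * card D))"
proof -
  define t where "t = - b / (1 - b)"
  have nz: "1 - b \<noteq> 0"
    using b by simp
  have t: "(1 + - b) * t = - b"
    using nz by (simp add: t_def)
  have "1 - t = 1 / (1 - b)"
    using nz by (simp add: t_def field_simps)
  moreover have "t - t\<^sup>2 = t * (1 - t)"
    by (simp add: algebra_simps power2_eq_square)
  ultimately have edge: "t - t\<^sup>2 = - b / (1 - b)\<^sup>2"
    by (simp add: t_def power2_eq_square)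
  have vertex: "1 - t * of_nat (q + 1) = (1 + of_nat q * b) / (1 - b)"
    using nz by (simp add: t_def field_simps)
  have "theta G b (2 * w) = (1 - b) ^ card (edges G) *
      (\<Sum>D\<in>matchings G (edges G). (t - t\<^sup>2) ^ card D *
        (\<Prod>i\<in>unmatched G D. 1 - t * of_nat (degree_in G (edges G) i)))"
    unfolding theta_double_root[OF G w]
    using sum_edge_sets_eq_sum_matchings[OF G t order_refl, of "\<lambda>_. 1"] by simp
  also have "(\<Sum>D\<in>matchings G (edges G). (t - t\<^sup>2) ^ card D *
        (\<Prod>i\<in>unmatched G D. 1 - t * of_nat (degree_in G (edges G) i))) =
      (\<Sum>D\<in>matchings G (edges G). (- b) ^ card D *
        (1 + of_nat q * b) ^ (card (verts G) - 2 * card D) / (1 - b) ^ card (verts G))"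
  proof (rule sum.cong[OF refl])
    fix D assume "D \<in> matchings G (edges G)"
    note card = card_unmatched[OF G this]
    have "(t - t\<^sup>2) ^ card D = (- b) ^ card D / (1 - b) ^ (2 * card D)"
      unfolding edge power_divide power_mult ..
    moreover have "(\<Prod>i\<in>unmatched G D. 1 - t * of_nat (degree_in G (edges G) i)) =
        (\<Prod>i\<in>unmatched G D. (1 + of_nat q * b) / (1 - b))"
      using reg vertex by (intro prod.cong) (auto simp: regular_def unmatched_def)
    ultimately show "(t - t\<^sup>2) ^ card D *
        (\<Prod>i\<in>unmatched G D. 1 - t * of_nat (degree_in G (edges G) i)) =
      (- b) ^ card D * (1 + of_nat q * b) ^ (card (verts G) - 2 * card D) / (1 - b) ^ card (verts G)"
      unfolding card by (simp add: power_divide power_add)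
  qed
  finally show ?thesis
    using nz by (simp add: power_int_diff sum_divide_distrib[symmetric])
qed

lemma map_poly_of_int_mult:
  "map_poly of_int (p * r) = (map_poly of_int p * map_poly of_int r :: 'a::comm_ring_1 poly)"
  by (rule poly_eqI) (simp add: coeff_map_poly coeff_mult)

lemma map_poly_of_int_power:
  "map_poly of_int (p ^ n) = (map_poly of_int p ^ n :: 'a::comm_ring_1 poly)"
  by (induction n) (simp_all add: map_poly_of_int_mult)

lemma map_poly_of_int_sum:
  "map_poly of_int (\<Sum>x\<in>A. p x) = (\<Sum>x\<in>A. map_poly of_int (p x) :: 'a::comm_ring_1 poly)"
  by (rule poly_eqI) (simp add: coeff_map_poly coeff_sum)

lemma to_fract_power: "to_fract (p ^ n) = to_fract p ^ n"
  by (induction n) simp_all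

lemma to_fract_of_nat: "to_fract (of_nat n) = of_nat n"
  by (induction n) simp_all

text \<open>The monomer-dimer form of \<open>\<omega>\<close>: \<open>-\<beta>\<close> for each edge of the matching, \<open>1 + q * \<beta>\<close> for each
  unmatched vertex.\<close>

lemma omega_regular:
  assumes G: "finite_multigraph G" and reg: "regular (q + 1) G"
  shows "omega G = to_fract (map_poly of_int
    (\<Sum>D\<in>matchings G (edges G). [:0, -1:] ^ card D * [:1, int q:] ^ (card (verts G) - 2 * card D)))"
proof -
  let ?b = "to_fract [:0, 1:] :: complex poly fract" and ?w = "to_fract [:\<i>:]"
  have "[:2 * \<i>:] = 2 * [:\<i>:]"
    by (simp add: numeral_poly)
  then have c: "to_fract [:2 * \<i>:] = 2 * ?w"
    by (metis to_fract_mult to_fract_of_nat of_nat_numeral)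
  have "[:\<i>:]\<^sup>2 = -1"
    by (simp add: power2_eq_square one_pCons)
  then have w: "?w\<^sup>2 = -1"
    by (metis to_fract_power to_fract_1 to_fract_uminus)
  have b: "?b \<noteq> 1"
    by (simp flip: to_fract_1 add: one_pCons)
  have edge: "to_fract (map_poly of_int [:0, -1:]) = - ?b"
    by (simp add: map_poly_pCons flip: to_fract_uminus)
  have "map_poly of_int [:1, int q:] = (1 + of_nat q * [:0, 1:] :: complex poly)"
    by (simp add: map_poly_pCons of_nat_poly one_pCons)
  then have vertex: "to_fract (map_poly of_int [:1, int q:]) = 1 + of_nat q * ?b"
    by (simp only: to_fract_add to_fract_mult to_fract_1 to_fract_of_nat)
  show ?thesis
    unfolding omega_def Let_def c theta_regular[OF G reg w b]
    by (simp only: map_poly_of_int_sum map_poly_of_int_mult map_poly_of_int_power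
        to_fract_sum to_fract_mult to_fract_power edge vertex)
qed

section \<open>Symmetry of the coefficients\<close>

lemma coeff_matching_term:
  "coeff ([:0, -1:] ^ j * [:1, int q:] ^ m) k =
    (if j \<le> k \<and> k - j \<le> m then (-1) ^ j * int (m choose (k - j)) * int q ^ (k - j) else 0)"
proof -
  have "[:0, -1:] = monom (-1 :: int) 1"
    by (simp add: monom_altdef)
  then have "coeff ([:0, -1:] ^ j * [:1, int q:] ^ m) k =
      (if j \<le> k then (-1) ^ j * coeff ([:1, int q:] ^ m) (k - j) else 0)"
    by (simp add: monom_power coeff_monom_mult)
  moreover have "coeff ([:1, int q:] ^ m) i = 0" if "m < i" for i
    using that degree_power_le[of "[:1, int q:]" m] degree_pCons_le[of 1 "[:int q:]"]
    by (intro coeff_eq_0) (simp split: if_splits)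
  ultimately show ?thesis
    by (auto simp: coeff_linear_poly_power)
qed

lemma coeff_matching_term_symmetric:
  assumes q: "q \<ge> 1" and N: "N = 2 * j + m" and k: "k \<le> N"
  shows "(of_int (coeff ([:0, -1:] ^ j * [:1, int q:] ^ m) (N - k)) :: rat) =
    of_int (coeff ([:0, -1:] ^ j * [:1, int q:] ^ m) k) * of_nat q powi (int N - 2 * int k)"
proof (cases "j \<le> k \<and> k - j \<le> m")
  case True
  define l where "l = k - j"
  have l: "k = j + l" "l \<le> m" "N - k = j + (m - l)"
    using True N by (auto simp: l_def)
  have "(of_nat q :: rat) ^ (m - l) = of_nat q ^ l * of_nat q powi (int N - 2 * int k)"
  proof -
    have "int (m - l) = int l + (int N - 2 * int k)"
      using l N by simp
    then show ?thesis
      using q by (metis power_int_add power_int_of_nat of_nat_eq_0_iff not_one_le_zero)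
  qed
  then show ?thesis
    using l by (simp add: coeff_matching_term binomial_symmetric[of l m])
next
  case False
  then have "\<not> (j \<le> N - k \<and> N - k - j \<le> m)"
    using N k by auto
  with False show ?thesis
    by (simp only: coeff_matching_term if_False of_int_0 mult_zero_left)
qed

theorem corollary1:
  fixes G :: "('v, 'e) multigraph" and q N :: nat
  assumes "finite_multigraph G"
    and "q \<ge> 1"
    and "regular (q + 1) G"
    and "card (verts G) = N"
  shows "\<exists>w :: int poly. omega G = to_fract (map_poly of_int w) \<and>
    (\<forall>k\<le>N. (of_int (coeff w (N - k)) :: rat) =
       of_int (coeff w k) * of_nat q powi (int N - 2 * int k))"
proof (intro exI conjI allI impI)
  let ?w = "\<Sum>D\<in>matchings G (edges G). [:0, -1:] ^ card D * [:1, int q:] ^ (N - 2 * card D)"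
  show "omega G = to_fract (map_poly of_int ?w)"
    using omega_regular[OF assms(1,3)] assms(4) by simp
  fix k assume "k \<le> N"
  moreover have "N = 2 * card D + (N - 2 * card D)" if "D \<in> matchings G (edges G)" for D
    using card_unmatched[OF assms(1) that] assms(4) by simp
  ultimately show "(of_int (coeff ?w (N - k)) :: rat) =
      of_int (coeff ?w k) * of_nat q powi (int N - 2 * int k)"
    unfolding coeff_sum of_int_sum sum_distrib_right
    by (intro sum.cong refl coeff_matching_term_symmetric[OF assms(2)])
qed

end
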